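(* Consider the Subgradient Descent Method $x^{i+1}=\Pi_Q(x^i-\alpha_ig_i)$, $g_i\in\partial f(x^i)$, started at $x^0\in Q$, applied to $f^*=\min_{x\in Q}f(x)$ with $f$ convex and Lipschitz with constant $M$, with step-sizes $$\alpha_i:=\frac{f(x^i)-f^*}{\|g_i\|^2}.$$ Let $f_{\mathrm{slb}}<f^*$ be a strict lower bound, $G$ the growth constant, and $\varepsilon'>0$. Suppose that $N\ge0$ is an integer satisfying $$N\ \ge\ 2M^2G^2\left(1+2.9\ln\left(\frac{f(x^0)-f^*}{f^*-f_{\mathrm{slb}}}\right)+2.9\ln\left(\frac1{\varepsilon'}\right)+6.8\left(\frac1{\varepsilon'}\right)+2\left(\frac1{\varepsilon'}\right)^2\right).$$ Then $$\frac{f(x_b^N)-f^*}{f^*-f_{\mathrm{slb}}}\le\varepsilon',$$ where $x_b^N$ is a point of lowest objective value among $x^0,\dots,x^N$.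
   Context: $Q\subseteq\mathbb{R}^n$ is closed and convex, $f$ is real-valued and convex on $Q$, and $f^*=\min_{x\in Q}f(x)$ is attained; $\mathrm{Opt}:=\{x\in Q:f(x)=f^*\}$. The norm is Euclidean, $\mathrm{Dist}(x,S):=\min_{y\in S}\|x-y\|$, and $\Pi_Q$ is Euclidean projection onto $Q$. The growth constant is $G:=\sup_{x\in Q}\mathrm{Dist}(x,\mathrm{Opt})/(f(x)-f_{\mathrm{slb}})$, assumed finite. $f$ satisfies $|f(y)-f(x)|\le M\|y-x\|$ for all $x,y$ in a relatively open set $\hat Q\supseteq Q$. $\partial f(x)$ is the set of $g$ with $f(y)\ge f(x)+g^T(y-x)$ for all $y\in Q$; all subgradients used satisfy $\|g\|\le M$. If $g_i=0$ (so $x^i$ is optimal) set $x^{i+1}=x^i$. If $f(x^0)=f^*$, the logarithm of $0$ is read as $-\infty$ (the conclusion is then trivial). *)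

theory Defs
  imports "HOL-Analysis.Analysis"
begin

text \<open>Where these constants are used the infimum is attained, so that it is a minimum.\<close>

definition opt_val :: "('a \<Rightarrow> real) \<Rightarrow> 'a set \<Rightarrow> real" where
  "opt_val f Q = (INF x\<in>Q. f x)"

definition Opt :: "('a \<Rightarrow> real) \<Rightarrow> 'a set \<Rightarrow> 'a set" where
  "Opt f Q = {x \<in> Q. f x = opt_val f Q}"

text \<open>The subgradient inequality is required on \<open>Q\<close> only, not on the whole space.\<close>

definition subdifferential :: "('a::real_inner \<Rightarrow> real) \<Rightarrow> 'a set \<Rightarrow> 'a \<Rightarrow> 'a set" where
  "subdifferential f Q x = {g. \<forall>y\<in>Q. f y \<ge> f x + g \<bullet> (y - x)}"

text \<open>The real-valued supremum below is meaningful only if the growth ratios are bounded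
  above; finiteness is the separate condition \<open>finite_growth\<close>.\<close>

definition growth_ratio :: "('a::metric_space \<Rightarrow> real) \<Rightarrow> 'a set \<Rightarrow> real \<Rightarrow> 'a \<Rightarrow> real" where
  "growth_ratio f Q fslb x = infdist x (Opt f Q) / (f x - fslb)"

definition finite_growth :: "('a::metric_space \<Rightarrow> real) \<Rightarrow> 'a set \<Rightarrow> real \<Rightarrow> bool" where
  "finite_growth f Q fslb \<longleftrightarrow> bdd_above (growth_ratio f Q fslb ` Q)"

definition growth_const :: "('a::metric_space \<Rightarrow> real) \<Rightarrow> 'a set \<Rightarrow> real \<Rightarrow> real" where
  "growth_const f Q fslb = (SUP x\<in>Q. growth_ratio f Q fslb x)"

definition subgradient_descent ::
  "('a::euclidean_space \<Rightarrow> real) \<Rightarrow> 'a set \<Rightarrow> (nat \<Rightarrow> real) \<Rightarrow> (nat \<Rightarrow> 'a) \<Rightarrow> (nat \<Rightarrow> 'a) \<Rightarrow> bool" where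
  "subgradient_descent f Q \<alpha> g x \<longleftrightarrow>
     x 0 \<in> Q \<and>
     (\<forall>i. g i \<in> subdifferential f Q (x i)) \<and>
     (\<forall>i. x (Suc i) = (if g i = 0 then x i else closest_point Q (x i - \<alpha> i *\<^sub>R g i)))"

definition best_iterate :: "('a \<Rightarrow> real) \<Rightarrow> (nat \<Rightarrow> 'a) \<Rightarrow> nat \<Rightarrow> 'a \<Rightarrow> bool" where
  "best_iterate f x N xb \<longleftrightarrow> xb \<in> x ` {..N} \<and> (\<forall>i\<le>N. f xb \<le> f (x i))"

end

theory Submission
  imports Defs
begin

text \<open>Put \<open>h = f* - f_slb\<close>, \<open>a i = (f (x i) - f*) / h\<close> and \<open>d i = Dist (x i, Opt) / (G h)\<close>. The growth
  constant gives \<open>d i \<le> 1 + a i\<close>, and the Polyak step-size gives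
  \<open>d (i+1)\<^sup>2 \<le> d i\<^sup>2 - a i\<^sup>2 / (M\<^sup>2 G\<^sup>2)\<close>. While \<open>a i > \<epsilon>'\<close> we have \<open>a i \<ge> s i\<close> for \<open>s i = max (d i - 1) \<epsilon>'\<close>,
  and the potential \<open>d\<^sup>2 / s\<^sup>2 + 2 ln s - 4 / s - 1 / s\<^sup>2\<close>, up to a constant the integral of \<open>du / (max (sqrt u - 1) \<epsilon>')\<^sup>2\<close>
  in \<open>u = d\<^sup>2\<close>, drops by at least \<open>1 / (M\<^sup>2 G\<^sup>2)\<close> in every step. This bounds the number of such steps,
  with better constants than required.\<close>

definition potential :: "real \<Rightarrow> real \<Rightarrow> real" where
  "potential d s = d\<^sup>2 / s\<^sup>2 + 2 * ln s - 4 / s - 1 / s\<^sup>2"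

text \<open>The terms in \<open>d\<close> cancel, and since \<open>t \<le> s\<close> the worst case
  is \<open>d' = 1 + t\<close>. Expanding \<open>(1 + t)\<^sup>2\<close> into \<open>1\<close>,
  \<open>2 * t\<close> and \<open>t\<^sup>2\<close>, each part times
  \<open>1 / t\<^sup>2 - 1 / s\<^sup>2\<close> is at most the increase from \<open>t\<close> to
  \<open>s\<close> of \<open>- 1 / s\<^sup>2\<close>, \<open>- 4 / s\<close> and
  \<open>2 * ln s\<close> respectively.\<close>

lemma potential_diff:
  assumes "0 < t" "t \<le> s" "0 \<le> d'" "d' \<le> 1 + t"
  shows "(d\<^sup>2 - d'\<^sup>2) / s\<^sup>2 \<le> potential d s - potential d' t"
proof -
  have s: "0 < s" using assms by simp
  have sq: "1 / s\<^sup>2 \<le> 1 / t\<^sup>2"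
    using assms s by (intro divide_left_mono power_mono) auto
  have "d'\<^sup>2 * (1 / t\<^sup>2 - 1 / s\<^sup>2) \<le> (1 + t)\<^sup>2 * (1 / t\<^sup>2 - 1 / s\<^sup>2)"
    using assms sq by (intro mult_right_mono power_mono) auto
  also have "\<dots> = (1 / t\<^sup>2 - 1 / s\<^sup>2) + (2 / t - 2 * t / s\<^sup>2) + (1 - t\<^sup>2 / s\<^sup>2)"
    using assms s by (simp add: field_simps power2_eq_square)
  also have "1 - t\<^sup>2 / s\<^sup>2 \<le> 2 * ln s - 2 * ln t"
  proof -
    have "ln (t\<^sup>2 / s\<^sup>2) \<le> t\<^sup>2 / s\<^sup>2 - 1"
      using assms s by (intro ln_le_minus_one) simp
    moreover have "ln (t\<^sup>2 / s\<^sup>2) = 2 * ln t - 2 * ln s"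
      using assms s by (simp add: ln_div ln_realpow)
    ultimately show ?thesis by linarith
  qed
  also have "2 / t - 2 * t / s\<^sup>2 \<le> 4 / t - 4 / s"
  proof -
    have "0 \<le> 2 * (s - t)\<^sup>2 / (t * s\<^sup>2)"
      using assms s by (intro divide_nonneg_nonneg) auto
    also have "\<dots> = (4 / t - 4 / s) - (2 / t - 2 * t / s\<^sup>2)"
      using assms s by (simp add: field_simps power2_eq_square)
    finally show ?thesis by linarith
  qed
  finally show ?thesis
    by (simp add: potential_def algebra_simps diff_divide_distrib)
qed

text \<open>Telescoping: the potential falls by at least \<open>1 / K\<close> per step, starts no
  higher than \<open>1 + 2 * ln (a 0)\<close> and ends no lower than
  \<open>2 * ln \<epsilon> - 4 / \<epsilon> - 1 / \<epsilon>\<^sup>2\<close>.\<close>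

lemma recurrence_length_bound:
  fixes a d :: "nat \<Rightarrow> real"
  assumes "0 < K" "0 < \<epsilon>"
    and large: "\<And>i. i < n \<Longrightarrow> \<epsilon> < a i"
    and growth: "\<And>i. i < n \<Longrightarrow> d i \<le> 1 + a i"
    and nonneg: "\<And>i. 0 \<le> d i"
    and step: "\<And>i. i < n \<Longrightarrow> (d (Suc i))\<^sup>2 \<le> (d i)\<^sup>2 - (a i)\<^sup>2 / K"
    and "0 < n"
  shows "real n \<le> K * (1 + 2 * ln (a 0 / \<epsilon>) + 4 * (1 / \<epsilon>) + (1 / \<epsilon>)\<^sup>2)"
proof -
  define s where "s i = max (d i - 1) \<epsilon>" for i
  define P where "P i = potential (d i) (s i)" for i
  \<comment> \<open>\<open>d i \<le> 1 + s i\<close> comes from the choice of \<open>s\<close>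
    alone, so it also holds at index \<open>n\<close>, where nothing is assumed about
    \<open>a n\<close>.\<close>
  have s_pos: "0 < s i" and s_ge: "\<epsilon> \<le> s i" and d_le: "d i \<le> 1 + s i" for i
    using \<open>0 < \<epsilon>\<close> by (auto simp: s_def)
  have drop: "P (Suc i) \<le> P i - 1 / K" if "i < n" for i
  proof -
    have "(d (Suc i))\<^sup>2 \<le> (d i)\<^sup>2"
      using step[OF that] \<open>0 < K\<close> by (smt (verit) divide_nonneg_pos zero_le_power2)
    then have "d (Suc i) \<le> d i"
      using nonneg power2_le_imp_le by blast
    then have "s (Suc i) \<le> s i" by (auto simp: s_def)
    then have pd: "((d i)\<^sup>2 - (d (Suc i))\<^sup>2) / (s i)\<^sup>2 \<le> P i - P (Suc i)"
      unfolding P_def by (intro potential_diff s_pos nonneg d_le)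
    have "s i \<le> a i"
      using large[OF that] growth[OF that] by (auto simp: s_def)
    then have "(s i)\<^sup>2 \<le> (a i)\<^sup>2"
      using s_pos[of i] by (intro power_mono) auto
    then have "(s i)\<^sup>2 / K \<le> (a i)\<^sup>2 / K"
      using \<open>0 < K\<close> by (intro divide_right_mono) auto
    then have "(s i)\<^sup>2 / K \<le> (d i)\<^sup>2 - (d (Suc i))\<^sup>2"
      using step[OF that] by linarith
    then have "((s i)\<^sup>2 / K) / (s i)\<^sup>2 \<le> ((d i)\<^sup>2 - (d (Suc i))\<^sup>2) / (s i)\<^sup>2"
      by (intro divide_right_mono) auto
    moreover have "((s i)\<^sup>2 / K) / (s i)\<^sup>2 = 1 / K"
      using s_pos[of i] by simp
    ultimately show ?thesis using pd by linarith
  qed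
  have "P m \<le> P 0 - real m / K" if "m \<le> n" for m
    using that
  proof (induction m)
    case (Suc m)
    then show ?case using drop[of m] by (simp add: add_divide_distrib)
  qed simp
  then have "real n / K \<le> P 0 - P n" by force
  \<comment> \<open>The last state is compared with a fictitious final one, \<open>d = 0\<close> and
    \<open>s = \<epsilon>\<close>.\<close>
  moreover have "potential 0 \<epsilon> \<le> P n"
  proof -
    have "((d n)\<^sup>2 - 0\<^sup>2) / (s n)\<^sup>2 \<le> P n - potential 0 \<epsilon>"
      unfolding P_def using \<open>0 < \<epsilon>\<close> s_ge by (intro potential_diff) auto
    moreover have "0 \<le> ((d n)\<^sup>2 - 0\<^sup>2) / (s n)\<^sup>2" by simp
    ultimately show ?thesis by linarith
  qed
  \<comment> \<open>With \<open>d 0 \<le> 1 + s 0\<close> the terms in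
    \<open>1 / (s 0)\<^sup>2\<close> cancel; the remaining \<open>- 2 / s 0\<close> is
    dropped.\<close>
  moreover have "P 0 \<le> 1 + 2 * ln (a 0)"
  proof -
    have "(d 0)\<^sup>2 / (s 0)\<^sup>2 \<le> (1 + s 0)\<^sup>2 / (s 0)\<^sup>2"
      using nonneg[of 0] d_le[of 0] by (intro divide_right_mono power_mono) auto
    also have "\<dots> = 1 + 2 / s 0 + 1 / (s 0)\<^sup>2"
      using s_pos[of 0] by (simp add: field_simps power2_eq_square)
    finally have "P 0 \<le> 1 + 2 * ln (s 0) - 2 / s 0"
      by (simp add: P_def potential_def)
    moreover have "ln (s 0) \<le> ln (a 0)"
      using s_pos[of 0] large[of 0] growth[of 0] \<open>0 < n\<close> by (auto simp: s_def)
    moreover have "0 \<le> 2 / s 0" using s_pos[of 0] by simp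
    ultimately show ?thesis by linarith
  qed
  moreover have "ln (a 0 / \<epsilon>) = ln (a 0) - ln \<epsilon>"
    using large[of 0] \<open>0 < n\<close> \<open>0 < \<epsilon>\<close> by (intro ln_divide_pos) auto
  ultimately have "real n / K \<le> 1 + 2 * ln (a 0 / \<epsilon>) + 4 * (1 / \<epsilon>) + (1 / \<epsilon>)\<^sup>2"
    by (simp add: potential_def power_one_over)
  then show ?thesis
    using \<open>0 < K\<close> by (simp add: pos_divide_le_eq mult.commute)
qed

text \<open>Attainment makes the infimum in \<open>opt_val\<close> a genuine value of
  \<open>f\<close>.\<close>

lemma Opt_iff_minimizer:
  assumes "\<exists>z\<in>Q. \<forall>y\<in>Q. f z \<le> (f y :: real)"
  shows "z \<in> Opt f Q \<longleftrightarrow> z \<in> Q \<and> (\<forall>y\<in>Q. f z \<le> f y)"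
proof -
  obtain w where w: "w \<in> Q" "\<And>y. y \<in> Q \<Longrightarrow> f w \<le> f y" using assms by blast
  then have "opt_val f Q = f w"
    unfolding opt_val_def by (intro cInf_eq_minimum) auto
  with w show ?thesis
    unfolding Opt_def by (auto intro: antisym)
qed

lemma closed_Opt:
  assumes "closed Q" "continuous_on Q f"
  shows "closed (Opt f Q)"
  unfolding Opt_def using assms by (intro continuous_closed_preimage_constant)

lemma infdist_Opt_le_growth_const:
  assumes "finite_growth f Q fslb" "x \<in> Q" "fslb < f x"
  shows "infdist x (Opt f Q) \<le> growth_const f Q fslb * (f x - fslb)"
proof -
  have "growth_ratio f Q fslb x \<le> growth_const f Q fslb"
    unfolding growth_const_def using assms(1,2)
    by (intro cSUP_upper) (auto simp: finite_growth_def)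
  then show ?thesis
    using assms(3) by (simp add: growth_ratio_def pos_divide_le_eq)
qed

text \<open>Projection fixes \<open>z\<close> and is nonexpansive, so it suffices to expand the
  square before projecting. The subgradient inequality bounds the cross term, and
  \<open>\<alpha>\<close> is the minimizer of the resulting quadratic \<open>- 2 * \<alpha> * (f x -
  f z) + \<alpha>\<^sup>2 * (norm g)\<^sup>2\<close>.\<close>

lemma polyak_step_dist:
  fixes x g z :: "'a::euclidean_space"
  assumes "convex Q" "closed Q" "z \<in> Q"
    and sub: "g \<in> subdifferential f Q x" and "g \<noteq> 0" and "f z \<le> f x"
    and "\<alpha> = (f x - f z) / (norm g)\<^sup>2"
  shows "(dist (closest_point Q (x - \<alpha> *\<^sub>R g)) z)\<^sup>2 \<le> (dist x z)\<^sup>2 - (f x - f z)\<^sup>2 / (norm g)\<^sup>2"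
proof -
  have "dist (closest_point Q (x - \<alpha> *\<^sub>R g)) (closest_point Q z) \<le> dist (x - \<alpha> *\<^sub>R g) z"
    using assms by (intro closest_point_lipschitz) auto
  then have "dist (closest_point Q (x - \<alpha> *\<^sub>R g)) z \<le> norm ((x - z) - \<alpha> *\<^sub>R g)"
    using \<open>z \<in> Q\<close> by (simp add: closest_point_self dist_norm algebra_simps)
  then have "(dist (closest_point Q (x - \<alpha> *\<^sub>R g)) z)\<^sup>2 \<le> (norm ((x - z) - \<alpha> *\<^sub>R g))\<^sup>2"
    by (intro power_mono) auto
  also have "\<dots> = (norm (x - z))\<^sup>2 - 2 * \<alpha> * (g \<bullet> (x - z)) + \<alpha>\<^sup>2 * (norm g)\<^sup>2"
    unfolding power2_norm_eq_inner
    by (simp add: inner_diff_left inner_diff_right inner_commute power2_eq_square algebra_simps)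
  also have "\<dots> \<le> (norm (x - z))\<^sup>2 - 2 * \<alpha> * (f x - f z) + \<alpha>\<^sup>2 * (norm g)\<^sup>2"
  proof -
    have "f x - f z \<le> g \<bullet> (x - z)"
      using sub \<open>z \<in> Q\<close> by (force simp: subdifferential_def inner_diff_right)
    moreover have "0 \<le> \<alpha>" using assms by simp
    ultimately show ?thesis by (simp add: mult_left_mono)
  qed
  also have "\<dots> = (dist x z)\<^sup>2 - (f x - f z)\<^sup>2 / (norm g)\<^sup>2"
  proof -
    have "f x - f z = \<alpha> * (norm g)\<^sup>2" using assms(5,7) by simp
    then show ?thesis using \<open>g \<noteq> 0\<close> by (simp add: dist_norm power2_eq_square)
  qed
  finally show ?thesis .
qed

theorem theorem3p2:
  fixes Q Qhat :: "(real ^ 'n) set" and f :: "real ^ 'n \<Rightarrow> real"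
    and x g :: "nat \<Rightarrow> real ^ 'n" and xb :: "real ^ 'n" and \<alpha> :: "nat \<Rightarrow> real"
    and M G fstar fslb \<epsilon>' :: real and N :: nat
  assumes "closed Q" and "convex Q" and "convex_on Q f"
    and attained: "\<exists>z\<in>Q. \<forall>y\<in>Q. f z \<le> f y"
    and fstar: "fstar = opt_val f Q"
    and "Q \<subseteq> Qhat" and "rel_open Qhat" and "M-lipschitz_on Qhat f"
    and "fslb < fstar"
    and "finite_growth f Q fslb" and G: "G = growth_const f Q fslb"
    and descent: "subgradient_descent f Q \<alpha> g x"
    and g_bound: "\<And>i. norm (g i) \<le> M"
    and step_size: "\<And>i. g i \<noteq> 0 \<Longrightarrow> \<alpha> i = (f (x i) - fstar) / (norm (g i))\<^sup>2"
    and "\<epsilon>' > 0"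
    and N: "f (x 0) \<noteq> fstar \<Longrightarrow>
      real N \<ge> 2 * M\<^sup>2 * G\<^sup>2 *
        (1 + 2.9 * ln ((f (x 0) - fstar) / (fstar - fslb)) + 2.9 * ln (1 / \<epsilon>')
           + 6.8 * (1 / \<epsilon>') + 2 * (1 / \<epsilon>')\<^sup>2)"
    and "best_iterate f x N xb"
  shows "(f xb - fstar) / (fstar - fslb) \<le> \<epsilon>'"
proof (rule ccontr)
  assume "\<not> ?thesis"
  then have bad: "\<epsilon>' < (f xb - fstar) / (fstar - fslb)" by simp
  define h where "h = fstar - fslb"
  define a where "a i = (f (x i) - fstar) / h" for i
  define D where "D i = infdist (x i) (Opt f Q)" for i
  have h: "0 < h" using \<open>fslb < fstar\<close> by (simp add: h_def)
  have min: "fstar \<le> f y" if "y \<in> Q" for y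
  proof -
    obtain z where "z \<in> Opt f Q" using attained Opt_iff_minimizer[OF attained] by blast
    then show ?thesis
      using that fstar Opt_iff_minimizer[OF attained] by (fastforce simp: Opt_def)
  qed
  have x0: "x 0 \<in> Q" and sub: "g i \<in> subdifferential f Q (x i)"
    and upd: "x (Suc i) = (if g i = 0 then x i else closest_point Q (x i - \<alpha> i *\<^sub>R g i))" for i
    using descent by (auto simp: subgradient_descent_def)
  have xQ: "x i \<in> Q" for i
  proof (induction i)
    case (Suc i)
    then show ?case using upd[of i] closest_point_in_set[of Q] \<open>closed Q\<close> by auto
  qed (rule x0)
  \<comment> \<open>Continuity makes \<open>Opt f Q\<close> closed, so each iterate has a nearest
    optimal point \<open>p i\<close>.\<close>
  have "continuous_on Q f"
    using \<open>M-lipschitz_on Qhat f\<close> \<open>Q \<subseteq> Qhat\<close>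
    by (meson lipschitz_on_continuous_on continuous_on_subset)
  then have "closed (Opt f Q)" using \<open>closed Q\<close> closed_Opt by blast
  moreover have "Opt f Q \<noteq> {}"
    using attained Opt_iff_minimizer[OF attained] by blast
  ultimately have "\<exists>z \<in> Opt f Q. D i = dist (x i) z" for i
    unfolding D_def by (metis infdist_attains_inf)
  then obtain p where p: "\<And>i. p i \<in> Opt f Q" "\<And>i. D i = dist (x i) (p i)" by metis
  have pQ: "p i \<in> Q" and fp: "f (p i) = fstar" for i
    using p(1)[of i] fstar by (auto simp: Opt_def)
  have large: "\<epsilon>' < a i" if "i \<le> N" for i
  proof -
    have "f xb \<le> f (x i)" using \<open>best_iterate f x N xb\<close> that by (simp add: best_iterate_def)
    then have "(f xb - fstar) / h \<le> a i"
      unfolding a_def using h by (intro divide_right_mono) auto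
    then show ?thesis using bad by (simp add: h_def)
  qed
  have sub_gap: "f (x i) - fstar \<le> g i \<bullet> (x i - p i)" for i
    using sub[of i] pQ[of i] fp[of i] by (force simp: subdifferential_def inner_diff_right)
  have gap_pos: "fstar < f (x i)" if "i \<le> N" for i
    using large[OF that] \<open>\<epsilon>' > 0\<close> h unfolding a_def
    by (smt (verit) divide_nonpos_pos)
  \<comment> \<open>A zero subgradient would close the gap, so up to \<open>N\<close> every update
    is a true projection step.\<close>
  have g_nz: "g i \<noteq> 0" if "i \<le> N" for i
    using sub_gap[of i] gap_pos[OF that] by auto
  have M: "0 < M" using g_nz[of 0] g_bound[of 0] by (smt (verit) zero_less_norm_iff zero_le)
  have D_le: "D i \<le> G * (f (x i) - fslb)" for i
    unfolding D_def G using \<open>finite_growth f Q fslb\<close> xQ[of i] min[OF xQ[of i]] \<open>fslb < fstar\<close>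
    by (intro infdist_Opt_le_growth_const) auto
  \<comment> \<open>If \<open>x 0\<close> coincided with \<open>p 0\<close>, \<open>sub_gap\<close>
    would leave no gap. A positive distance in turn forces \<open>G > 0\<close>, which permits
    scaling by \<open>G * h\<close>.\<close>
  have "0 < D 0"
    using sub_gap[of 0] gap_pos[of 0] p(2)[of 0] by auto
  then have "0 < G * (f (x 0) - fslb)" using D_le[of 0] by linarith
  then have Gpos: "0 < G"
    using gap_pos[of 0] \<open>fslb < fstar\<close> by (simp add: zero_less_mult_iff)
  have step: "(D (Suc i))\<^sup>2 \<le> (D i)\<^sup>2 - (f (x i) - fstar)\<^sup>2 / M\<^sup>2" if "i \<le> N" for i
  proof -
    \<comment> \<open>The old nearest point \<open>p i\<close> still bounds the new distance to
      \<open>Opt f Q\<close>.\<close>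
    have "(D (Suc i))\<^sup>2 \<le> (dist (x (Suc i)) (p i))\<^sup>2"
      unfolding D_def using infdist_le[OF p(1)] infdist_nonneg by (intro power_mono) auto
    also have "\<dots> \<le> (D i)\<^sup>2 - (f (x i) - fstar)\<^sup>2 / (norm (g i))\<^sup>2"
      using polyak_step_dist[OF \<open>convex Q\<close> \<open>closed Q\<close> pQ[of i] sub[of i] g_nz[OF that]]
        gap_pos[OF that] step_size[OF g_nz[OF that]] upd[of i] g_nz[OF that] fp[of i] p(2)[of i]
      by simp
    also have "\<dots> \<le> (D i)\<^sup>2 - (f (x i) - fstar)\<^sup>2 / M\<^sup>2"
      using g_bound[of i] g_nz[OF that] M
      by (intro diff_left_mono divide_left_mono power_mono) auto
    finally show ?thesis .
  qed
  define d where "d i = D i / (G * h)" for i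
  \<comment> \<open>All \<open>N + 1\<close> indices \<open>0, ..., N\<close> are bad; this extra
    one yields the final contradiction \<open>N + 1 \<le> N\<close>.\<close>
  have "real (Suc N) \<le>
      (M * G)\<^sup>2 * (1 + 2 * ln (a 0 / \<epsilon>') + 4 * (1 / \<epsilon>') + (1 / \<epsilon>')\<^sup>2)"
  proof (rule recurrence_length_bound[where d = d])
    show "0 < (M * G)\<^sup>2" using M Gpos by simp
    show "0 \<le> d i" for i using Gpos h by (simp add: d_def D_def infdist_nonneg)
    show "d i \<le> 1 + a i" for i
    proof -
      have "d i \<le> G * (f (x i) - fslb) / (G * h)"
        unfolding d_def using D_le[of i] Gpos h by (intro divide_right_mono) auto
      also have "\<dots> = (h + (f (x i) - fstar)) / h" using Gpos by (simp add: h_def)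
      also have "\<dots> = 1 + a i" using h by (simp add: a_def add_divide_distrib)
      finally show ?thesis .
    qed
    show "(d (Suc i))\<^sup>2 \<le> (d i)\<^sup>2 - (a i)\<^sup>2 / (M * G)\<^sup>2" if "i < Suc N" for i
    proof -
      have "(D (Suc i))\<^sup>2 / (G * h)\<^sup>2 \<le> ((D i)\<^sup>2 - (f (x i) - fstar)\<^sup>2 / M\<^sup>2) / (G * h)\<^sup>2"
        using step[of i] that by (intro divide_right_mono) auto
      moreover have "f (x i) - fstar = h * a i" using h by (simp add: a_def)
      ultimately show ?thesis
        using h by (simp add: d_def power_divide power_mult_distrib diff_divide_distrib mult_ac)
    qed
  qed (use large \<open>\<epsilon>' > 0\<close> in auto)
  \<comment> \<open>The comparison is coefficientwise; the logarithm is nonnegative because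
    \<open>a 0 > \<epsilon>'\<close>.\<close>
  also have "\<dots> \<le> (M * G)\<^sup>2 * (2 * (1 + 2.9 * ln (a 0 / \<epsilon>') + 6.8 * (1 / \<epsilon>') + 2 * (1 / \<epsilon>')\<^sup>2))"
  proof -
    have *: "1 + 2 * L + 4 * e + q \<le> 2 * (1 + 2.9 * L + 6.8 * e + 2 * q)"
      if "0 \<le> L" "0 \<le> e" "0 \<le> q" for L e q :: real
      using that by simp
    have "0 \<le> ln (a 0 / \<epsilon>')" using large[of 0] \<open>\<epsilon>' > 0\<close> by simp
    moreover have "0 \<le> 1 / \<epsilon>'" using \<open>\<epsilon>' > 0\<close> by simp
    moreover have "0 \<le> (1 / \<epsilon>')\<^sup>2" by simp
    ultimately show ?thesis by (intro mult_left_mono *) auto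
  qed
  also have "ln (a 0 / \<epsilon>') = ln (a 0) + ln (1 / \<epsilon>')"
    using large[of 0] \<open>\<epsilon>' > 0\<close> by (simp add: ln_div)
  \<comment> \<open>The bound on \<open>N\<close> is available since \<open>gap_pos\<close> excludes
    an optimal start, the case of the logarithm of 0.\<close>
  also have "(M * G)\<^sup>2 * (2 * (1 + 2.9 * (ln (a 0) + ln (1 / \<epsilon>')) + 6.8 * (1 / \<epsilon>') + 2 * (1 / \<epsilon>')\<^sup>2))
      \<le> real N"
    using N gap_pos[of 0] by (simp add: a_def h_def power_mult_distrib algebra_simps)
  finally show False by simp
qed

end
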